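(* Let $m\ge 2$ be an integer. The function $[a,b]\mapsto s^{a\times b}$ is an injection from the set of reduced positive roots $[a,b]$ of $\mathcal H(m)$ with $a\ge b$ into $W(m)$.
   Context: $W(m)=\langle s_1,s_2,s_3 : s_1^2=s_2^2=s_3^2=(s_1s_2)^m=(s_2s_3)^m=e\rangle$. $\mathcal H(m)$ is the rank 2 Kac--Moody algebra with Cartan matrix $\begin{pmatrix}2&-m\\-m&2\end{pmatrix}$; $[a,b]$ ($a,b\in\mathbb Z$) denotes an element of its root lattice, with $[1,0],[0,1]$ the positive simple roots. A root $[a,b]$ is reduced if $\gcd(a,b)=1$ and $ab\neq 0$; equivalently, $[a,b]$ is a reduced positive root iff $a,b$ are coprime positive integers with $a^2+b^2-mab\le1$. For positive integers $a\ge b$, the maximal Dyck path $\mathcal D^{a\times b}$ is the lattice path (unit steps right and up) from $(0,0)$ to $(a,b)$ that is as close as possible to the diagonal joining $(0,0)$ and $(a,b)$ without ever going above it. Assign $s_2s_3$ to each horizontal edge and $s_2s_1$ to each vertical edge of $\mathcal D^{a\times b}$; $s^{a\times b}\in W(m)$ is the product of these elements read in the order of the edges along $\mathcal D^{a\times b}$ starting from $(0,0)$. *)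

theory Defs
  imports "HOL-Algebra.Group"
begin

section \<open>Groups given by generators and relators\<close>

text \<open>
  A letter \<open>(g, True)\<close> stands for the generator \<open>g\<close>, and \<open>(g, False)\<close> for its formal inverse.
\<close>

type_synonym 'g word = "('g \<times> bool) list"

inductive pres_eq :: "'g word set \<Rightarrow> 'g word \<Rightarrow> 'g word \<Rightarrow> bool" for R where
  cancel: "pres_eq R (u @ [(g, e), (g, \<not> e)] @ v) (u @ v)"
| relator: "r \<in> R \<Longrightarrow> pres_eq R (u @ r @ v) (u @ v)"
| refl: "pres_eq R u u"
| sym: "pres_eq R u v \<Longrightarrow> pres_eq R v u"
| trans: "pres_eq R u v \<Longrightarrow> pres_eq R v w \<Longrightarrow> pres_eq R u w"

definition pres_class :: "'g word set \<Rightarrow> 'g word \<Rightarrow> 'g word set" where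
  "pres_class R u = {v. pres_eq R u v}"

definition presented_group :: "'g word set \<Rightarrow> 'g word set monoid" where
  "presented_group R =
     \<lparr> carrier = range (pres_class R),
       monoid.mult = (\<lambda>X Y. \<Union>x\<in>X. \<Union>y\<in>Y. pres_class R (x @ y)),
       one = pres_class R [] \<rparr>"

definition pres_gen :: "'g word set \<Rightarrow> 'g \<Rightarrow> 'g word set" where
  "pres_gen R g = pres_class R [(g, True)]"

lemma pres_eq_context: "pres_eq R u v \<Longrightarrow> pres_eq R (p @ u @ q) (p @ v @ q)"
proof (induction rule: pres_eq.induct)
  case (cancel u g e v)
  show ?case using pres_eq.cancel[of R "p @ u" g e "v @ q"] by simp
next
  case (relator r u v)
  then show ?case using pres_eq.relator[of r R "p @ u" "v @ q"] by simp
next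
  case (refl u)
  show ?case by (rule pres_eq.refl)
next
  case (sym u v)
  then show ?case by (blast intro: pres_eq.sym)
next
  case (trans u v w)
  then show ?case by (blast intro: pres_eq.trans)
qed

lemma pres_eq_append: "pres_eq R u u' \<Longrightarrow> pres_eq R v v' \<Longrightarrow> pres_eq R (u @ v) (u' @ v')"
  using pres_eq_context[of R u u' "[]" v] pres_eq_context[of R v v' u' "[]"]
  by (simp) (rule pres_eq.trans)

lemma pres_class_eq_iff: "pres_class R u = pres_class R v \<longleftrightarrow> pres_eq R u v"
  unfolding pres_class_def by (blast intro: pres_eq.refl pres_eq.sym pres_eq.trans)

lemma presented_group_mult:
  "pres_class R u \<otimes>\<^bsub>presented_group R\<^esub> pres_class R v = pres_class R (u @ v)"
proof -
  have eq: "pres_class R (x @ y) = pres_class R (u @ v)"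
    if "x \<in> pres_class R u" "y \<in> pres_class R v" for x y
    using that unfolding pres_class_eq_iff
    by (auto simp: pres_class_def intro: pres_eq_append pres_eq.sym)
  have "u \<in> pres_class R u" "v \<in> pres_class R v"
    by (auto simp: pres_class_def intro: pres_eq.refl)
  then have "(\<Union>x\<in>pres_class R u. \<Union>y\<in>pres_class R v. pres_class R (x @ y)) = pres_class R (u @ v)"
    using eq by blast
  then show ?thesis by (simp add: presented_group_def)
qed

lemma group_presented_group: "group (presented_group R)"
proof (rule groupI)
  show "x \<otimes>\<^bsub>presented_group R\<^esub> y \<in> carrier (presented_group R)"
    if "x \<in> carrier (presented_group R)" "y \<in> carrier (presented_group R)" for x y
    using that presented_group_mult[of R] by (auto simp: presented_group_def)
  show "\<one>\<^bsub>presented_group R\<^esub> \<in> carrier (presented_group R)"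
    by (simp add: presented_group_def)
next
  fix x y z
  assume "x \<in> carrier (presented_group R)" "y \<in> carrier (presented_group R)"
    "z \<in> carrier (presented_group R)"
  then obtain u v w where "x = pres_class R u" "y = pres_class R v" "z = pres_class R w"
    by (auto simp: presented_group_def)
  then show "x \<otimes>\<^bsub>presented_group R\<^esub> y \<otimes>\<^bsub>presented_group R\<^esub> z
      = x \<otimes>\<^bsub>presented_group R\<^esub> (y \<otimes>\<^bsub>presented_group R\<^esub> z)"
    by (simp add: presented_group_mult)
next
  fix x assume "x \<in> carrier (presented_group R)"
  then obtain u where u: "x = pres_class R u" by (auto simp: presented_group_def)
  have one: "\<one>\<^bsub>presented_group R\<^esub> = pres_class R []" by (simp add: presented_group_def)
  show "\<one>\<^bsub>presented_group R\<^esub> \<otimes>\<^bsub>presented_group R\<^esub> x = x"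
    by (simp add: u one presented_group_mult)
  define inv_word :: "'a word \<Rightarrow> 'a word" where
    "inv_word w = rev (map (\<lambda>(g, e). (g, \<not> e)) w)" for w
  have "pres_eq R (inv_word u @ u) []"
  proof (induction u)
    case Nil
    show ?case by (simp add: inv_word_def pres_eq.refl)
  next
    case (Cons l u)
    obtain g e where l: "l = (g, e)" by force
    have "pres_eq R (inv_word u @ [(g, \<not> e), (g, \<not> \<not> e)] @ u) (inv_word u @ u)"
      by (rule pres_eq.cancel)
    with Cons have "pres_eq R (inv_word u @ [(g, \<not> e), (g, \<not> \<not> e)] @ u) []"
      by (blast intro: pres_eq.trans)
    then show ?case by (simp add: l inv_word_def)
  qed
  then have "pres_class R (inv_word u) \<otimes>\<^bsub>presented_group R\<^esub> x = \<one>\<^bsub>presented_group R\<^esub>"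
    by (simp add: u one presented_group_mult pres_class_eq_iff)
  then show "\<exists>y\<in>carrier (presented_group R). y \<otimes>\<^bsub>presented_group R\<^esub> x = \<one>\<^bsub>presented_group R\<^esub>"
    by (auto simp: presented_group_def)
qed


section \<open>The group \<open>W(m)\<close>\<close>

datatype gen = S1 | S2 | S3

definition W_relators :: "nat \<Rightarrow> gen word set" where
  "W_relators m =
     {[(S1, True), (S1, True)], [(S2, True), (S2, True)], [(S3, True), (S3, True)],
      concat (replicate m [(S1, True), (S2, True)]),
      concat (replicate m [(S2, True), (S3, True)])}"

definition W :: "nat \<Rightarrow> gen word set monoid" where
  "W m = presented_group (W_relators m)"

definition W_gen :: "nat \<Rightarrow> gen \<Rightarrow> gen word set" where
  "W_gen m g = pres_gen (W_relators m) g"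


section \<open>Roots of the rank 2 Kac--Moody algebra\<close>

text \<open>
  An element \<open>a\<alpha>\<^sub>1 + b\<alpha>\<^sub>2\<close> of the root lattice is represented by the pair \<open>(a, b)\<close>; the index
  of a simple root is \<open>1\<close> or \<open>2\<close>.
\<close>

definition cartan :: "nat \<Rightarrow> nat \<Rightarrow> nat \<Rightarrow> int" where
  "cartan m i j = (if i = j then 2 else - int m)"

text \<open>\<open>coroot_pairing m i v\<close> is the value of \<open>v\<close> at the simple coroot \<open>\<alpha>\<^sub>i\<^sup>\<or>\<close>.\<close>

definition coroot_pairing :: "nat \<Rightarrow> nat \<Rightarrow> int \<times> int \<Rightarrow> int" where
  "coroot_pairing m i v = cartan m i 1 * fst v + cartan m i 2 * snd v"

definition simple_reflection :: "nat \<Rightarrow> nat \<Rightarrow> int \<times> int \<Rightarrow> int \<times> int" where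
  "simple_reflection m i v =
     (if i = 1 then (fst v - coroot_pairing m 1 v, snd v)
      else (fst v, snd v - coroot_pairing m 2 v))"

inductive_set weyl_orbit :: "nat \<Rightarrow> (int \<times> int) set \<Rightarrow> (int \<times> int) set" for m S where
  base: "v \<in> S \<Longrightarrow> v \<in> weyl_orbit m S"
| reflect: "v \<in> weyl_orbit m S \<Longrightarrow> i \<in> {1, 2} \<Longrightarrow> simple_reflection m i v \<in> weyl_orbit m S"

definition real_roots :: "nat \<Rightarrow> (int \<times> int) set" where
  "real_roots m = weyl_orbit m {(1, 0), (0, 1)}"

text \<open>
  The roots are given by Kac's description of the root system of a Kac--Moody algebra in terms
  of its Cartan matrix: the imaginary roots are the Weyl group translates of \<open>\<plusminus>v\<close>, where \<open>v\<close>
  is a nonzero element of the nonnegative cone with connected support, on which all simple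
  coroots are nonpositive.  For \<open>m > 0\<close> the two simple roots are joined, so every support is
  connected and that condition is void here.
\<close>

definition fundamental_set :: "nat \<Rightarrow> (int \<times> int) set" where
  "fundamental_set m =
     {v. v \<noteq> (0, 0) \<and> fst v \<ge> 0 \<and> snd v \<ge> 0 \<and> (\<forall>i\<in>{1, 2}. coroot_pairing m i v \<le> 0)}"

definition imaginary_roots :: "nat \<Rightarrow> (int \<times> int) set" where
  "imaginary_roots m = weyl_orbit m (fundamental_set m \<union> {(- a, - b) | a b. (a, b) \<in> fundamental_set m})"

definition roots :: "nat \<Rightarrow> (int \<times> int) set" where
  "roots m = real_roots m \<union> imaginary_roots m"

definition positive_roots :: "nat \<Rightarrow> (int \<times> int) set" where
  "positive_roots m = {v \<in> roots m. fst v \<ge> 0 \<and> snd v \<ge> 0}"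

definition reduced_positive_roots :: "nat \<Rightarrow> (int \<times> int) set" where
  "reduced_positive_roots m = {(a, b) \<in> positive_roots m. coprime a b \<and> a * b \<noteq> 0}"

lemma simple_reflection_simps:
  "simple_reflection m 1 (a, b) = (int m * b - a, b)"
  "simple_reflection m (Suc 0) (a, b) = (int m * b - a, b)"
  "simple_reflection m 2 (a, b) = (a, int m * a - b)"
  by (simp_all add: simple_reflection_def coroot_pairing_def cartan_def)

lemma weyl_orbit_form:
  assumes "v \<in> weyl_orbit m S"
    and "\<And>a b. (a, b) \<in> S \<Longrightarrow> a\<^sup>2 + b\<^sup>2 - int m * a * b \<le> 1"
  shows "(fst v)\<^sup>2 + (snd v)\<^sup>2 - int m * fst v * snd v \<le> 1"
  using assms(1)
proof (induction rule: weyl_orbit.induct)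
  case (base v)
  then show ?case using assms(2)[of "fst v" "snd v"] by simp
next
  case (reflect v i)
  obtain a b where v: "v = (a, b)" by force
  from reflect show ?case
    by (auto simp: v simple_reflection_simps power2_eq_square algebra_simps)
qed

lemma roots_form:
  assumes "(a, b) \<in> roots m"
  shows "a\<^sup>2 + b\<^sup>2 - int m * a * b \<le> 1"
proof -
  have fund: "x\<^sup>2 + y\<^sup>2 - int m * x * y \<le> 1" if "(x, y) \<in> fundamental_set m" for x y
  proof -
    from that have "x \<ge> 0" "y \<ge> 0" "2 * x - int m * y \<le> 0" "2 * y - int m * x \<le> 0"
      by (auto simp: fundamental_set_def coroot_pairing_def cartan_def)
    then have "x * (2 * x - int m * y) \<le> 0" "y * (2 * y - int m * x) \<le> 0"
      by (auto simp: mult_nonneg_nonpos)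
    then show ?thesis by (simp add: power2_eq_square algebra_simps)
  qed
  have "(a, b) \<in> weyl_orbit m ({(1, 0), (0, 1)})
     \<or> (a, b) \<in> weyl_orbit m (fundamental_set m \<union> {(- a, - b) | a b. (a, b) \<in> fundamental_set m})"
    using assms by (simp add: roots_def real_roots_def imaginary_roots_def)
  then show ?thesis
  proof
    assume "(a, b) \<in> weyl_orbit m ({(1, 0), (0, 1)})"
    then show ?thesis by (auto dest!: weyl_orbit_form)
  next
    assume "(a, b) \<in> weyl_orbit m (fundamental_set m \<union> {(- a, - b) | a b. (a, b) \<in> fundamental_set m})"
    from weyl_orbit_form[OF this] show ?thesis using fund by fastforce
  qed
qed

lemma roots_reflect:
  assumes "simple_reflection m i v \<in> roots m" "i \<in> {1, 2}"
  shows "v \<in> roots m"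
proof -
  have "simple_reflection m i (simple_reflection m i v) \<in> roots m"
    using assms unfolding roots_def real_roots_def imaginary_roots_def
    by (auto intro: weyl_orbit.reflect)
  moreover have "simple_reflection m i (simple_reflection m i v) = v"
    using assms(2) by (cases v) (auto simp: simple_reflection_simps)
  ultimately show ?thesis by simp
qed

lemma roots_of_form:
  assumes "a > 0" "b > 0" "coprime a b" "a\<^sup>2 + b\<^sup>2 - int m * a * b \<le> 1"
  shows "(a, b) \<in> roots m"
  using assms
proof (induction "nat (a + b)" arbitrary: a b rule: less_induct)
  case less
  have step: "(if i = 1 then (x, y) else (y, x)) \<in> roots m"
    if i: "i \<in> {1, 2}" and gt: "2 * x > int m * y" and pos: "x > 0" "y > 0"
      and cop: "coprime x y" and form: "x\<^sup>2 + y\<^sup>2 - int m * x * y \<le> 1" and sum: "x + y = a + b"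
    for x y and i :: nat
  proof -
    let ?x = "int m * y - x"
    have le: "?x \<ge> 0"
    proof (rule ccontr)
      assume "\<not> ?x \<ge> 0"
      then have "x * (x - int m * y) \<ge> 1 * 1" using pos by (intro mult_mono) auto
      moreover have "y\<^sup>2 > 0" using pos by simp
      ultimately show False using form by (simp add: power2_eq_square algebra_simps)
    qed
    have refl: "simple_reflection m i (if i = 1 then (x, y) else (y, x)) = (if i = 1 then (?x, y) else (y, ?x))"
      using i by (auto simp: simple_reflection_simps)
    have "(if i = 1 then (?x, y) else (y, ?x)) \<in> roots m"
    proof (cases "?x = 0")
      case True
      then have "x = int m * y" by simp
      then have "y = 1" using cop pos by simp
      then show ?thesis using True i
        by (auto simp: roots_def real_roots_def intro: weyl_orbit.base)
    next
      case False
      have "coprime ?x y"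
      proof (rule coprimeI)
        fix d assume "d dvd ?x" "d dvd y"
        then have "d dvd int m * y - ?x" by (meson dvd_diff dvd_mult)
        then have "d dvd x" by simp
        then show "is_unit d" using cop \<open>d dvd y\<close> by (auto dest: coprime_common_divisor)
      qed
      then show ?thesis
        using less.hyps[of ?x y] less.hyps[of y ?x] le False gt pos sum form i
        by (auto simp: power2_eq_square algebra_simps coprime_commute)
    qed
    then show ?thesis using roots_reflect[of m i] refl i by metis
  qed
  consider "2 * a > int m * b" | "2 * b > int m * a" | "2 * a \<le> int m * b" "2 * b \<le> int m * a"
    by linarith
  then show ?case
  proof cases
    case 1
    then show ?thesis using step[where i = 1 and x = a and y = b] less.prems by simp
  next
    case 2
    then show ?thesis using step[where i = 2 and x = b and y = a] less.prems
      by (simp add: algebra_simps coprime_commute)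
  next
    case 3
    then have "(a, b) \<in> fundamental_set m" using less.prems
      by (auto simp: fundamental_set_def coroot_pairing_def cartan_def)
    then show ?thesis by (auto simp: roots_def imaginary_roots_def intro: weyl_orbit.base)
  qed
qed

text \<open>The explicit form of the set of reduced positive roots.\<close>

lemma reduced_positive_roots_iff:
  "(a, b) \<in> reduced_positive_roots m \<longleftrightarrow>
     a > 0 \<and> b > 0 \<and> coprime a b \<and> a\<^sup>2 + b\<^sup>2 - int m * a * b \<le> 1"
  using roots_form[of a b m] roots_of_form[of a b m]
  by (auto simp: reduced_positive_roots_def positive_roots_def)


section \<open>Maximal Dyck paths\<close>

datatype edge = Horizontal | Vertical

text \<open>
  The path starts at the origin; after \<open>k\<close> edges it is at the point whose coordinates are the
  numbers of horizontal and vertical edges in \<open>take k p\<close>.  A path of right and up steps stays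
  weakly below the diagonal iff its vertices do.
\<close>

definition dyck_path :: "nat \<Rightarrow> nat \<Rightarrow> edge list \<Rightarrow> bool" where
  "dyck_path a b p \<longleftrightarrow>
     count_list p Horizontal = a \<and> count_list p Vertical = b \<and>
     (\<forall>k \<le> length p. a * count_list (take k p) Vertical \<le> b * count_list (take k p) Horizontal)"

text \<open>
  Closeness to the diagonal is compared along the antidiagonals \<open>x + y = k\<close>, each of which meets
  a path from \<open>(0, 0)\<close> to \<open>(a, b)\<close> in exactly one vertex for \<open>k \<le> a + b\<close>.
\<close>

definition maximal_dyck_path :: "nat \<Rightarrow> nat \<Rightarrow> edge list \<Rightarrow> bool" where
  "maximal_dyck_path a b p \<longleftrightarrow>
     dyck_path a b p \<and>
     (\<forall>q. dyck_path a b q \<longrightarrow>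
        (\<forall>k \<le> a + b. count_list (take k q) Vertical \<le> count_list (take k p) Vertical))"

definition the_maximal_dyck_path :: "nat \<Rightarrow> nat \<Rightarrow> edge list" where
  "the_maximal_dyck_path a b = (THE p. maximal_dyck_path a b p)"

lemma count_list_edge: "count_list p Horizontal + count_list p Vertical = length p"
proof (induction p)
  case (Cons x p)
  then show ?case by (cases x) auto
qed simp

lemma edge_lists_eqI:
  assumes "length p = length q"
    and "\<And>k. k \<le> length p \<Longrightarrow> count_list (take k p) Vertical = count_list (take k q) Vertical"
  shows "p = q"
proof (rule nth_equalityI)
  fix k assume k: "k < length p"
  have "count_list (take (Suc k) p) Vertical = count_list (take (Suc k) q) Vertical"
    "count_list (take k p) Vertical = count_list (take k q) Vertical"
    using assms(2)[of k] assms(2)[of "Suc k"] k by auto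
  then show "p ! k = q ! k" using k assms(1)
    by (cases "p ! k"; cases "q ! k") (auto simp: take_Suc_conv_app_nth)
qed (fact assms(1))

lemma ex1_maximal_dyck_path:
  assumes "a > 0" "b > 0"
  shows "\<exists>!p. maximal_dyck_path a b p"
proof (rule ex_ex1I)
  define h where "h k = (b * k) div (a + b)" for k
  define p where "p = map (\<lambda>k. if h (Suc k) = h k then Horizontal else Vertical) [0..<a + b]"
  have len: "length p = a + b" by (simp add: p_def)
  have h0: "h 0 = 0" and hend: "h (a + b) = b" using assms by (simp_all add: h_def)
  have hstep: "h (Suc k) = h k \<or> h (Suc k) = Suc (h k)" for k
  proof -
    have "h k \<le> h (Suc k)" by (auto simp: h_def intro: div_le_mono)
    moreover have "h (Suc k) \<le> (b * k + (a + b)) div (a + b)"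
      unfolding h_def by (rule div_le_mono) simp
    moreover have "(b * k + (a + b)) div (a + b) = Suc (h k)"
      using assms by (simp add: h_def div_add_self2)
    ultimately show ?thesis by linarith
  qed
  have cnt: "count_list (take k p) Vertical = h k" if "k \<le> a + b" for k
    using that
  proof (induction k)
    case 0
    show ?case by (simp add: h0)
  next
    case (Suc k)
    then have "take (Suc k) p = take k p @ [p ! k]" by (simp add: len take_Suc_conv_app_nth)
    moreover have "p ! k = (if h (Suc k) = h k then Horizontal else Vertical)"
      using Suc.prems by (simp add: p_def nth_append)
    ultimately show ?case using Suc hstep[of k] by auto
  qed
  have cntH: "count_list (take k p) Horizontal = k - h k" "h k \<le> k" if "k \<le> a + b" for k
    using count_list_edge[of "take k p"] cnt[OF that] that by (auto simp: len)
  have "dyck_path a b p"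
    unfolding dyck_path_def
  proof (intro conjI allI impI)
    show "count_list p Vertical = b" using cnt[of "a + b"] hend by (simp add: len[symmetric])
    then show "count_list p Horizontal = a" using count_list_edge[of p] len by simp
    fix k assume "k \<le> length p"
    then have k: "k \<le> a + b" by (simp add: len)
    have "h k * (a + b) \<le> b * k" unfolding h_def by simp
    then show "a * count_list (take k p) Vertical \<le> b * count_list (take k p) Horizontal"
      using cntH[OF k] cnt[OF k] by (simp add: algebra_simps)
  qed
  moreover have "count_list (take k q) Vertical \<le> count_list (take k p) Vertical"
    if q: "dyck_path a b q" and k: "k \<le> a + b" for q k
  proof -
    let ?v = "count_list (take k q) Vertical"
    have lq: "length q = a + b" using q count_list_edge[of q] by (simp add: dyck_path_def)
    have "count_list (take k q) Horizontal + ?v = k"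
      using count_list_edge[of "take k q"] lq k by simp
    moreover have "a * ?v \<le> b * count_list (take k q) Horizontal"
      using q k lq by (simp add: dyck_path_def)
    ultimately have "a * ?v + b * ?v \<le> b * k"
      by (metis add_le_mono1 add_mult_distrib2)
    then have "?v * (a + b) \<le> b * k" by (simp add: algebra_simps)
    then have "?v \<le> h k" using assms by (simp add: h_def less_eq_div_iff_mult_less_eq)
    then show ?thesis using cnt[OF k] by simp
  qed
  ultimately show "\<exists>p. maximal_dyck_path a b p" by (auto simp: maximal_dyck_path_def)
next
  fix p q assume p: "maximal_dyck_path a b p" and q: "maximal_dyck_path a b q"
  have "length p = a + b" "length q = a + b"
    using p q count_list_edge[of p] count_list_edge[of q]
    by (auto simp: maximal_dyck_path_def dyck_path_def)
  then show "p = q"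
    using p q by (intro edge_lists_eqI) (auto simp: maximal_dyck_path_def intro: le_antisym)
qed


section \<open>The elements \<open>s\<^sup>a\<^sup>\<times>\<^sup>b\<close>\<close>

fun edge_elt :: "nat \<Rightarrow> edge \<Rightarrow> gen word set" where
  "edge_elt m Horizontal = W_gen m S2 \<otimes>\<^bsub>W m\<^esub> W_gen m S3"
| "edge_elt m Vertical = W_gen m S2 \<otimes>\<^bsub>W m\<^esub> W_gen m S1"

definition s_dyck :: "nat \<Rightarrow> nat \<Rightarrow> nat \<Rightarrow> gen word set" where
  "s_dyck m a b =
     foldr (\<lambda>e x. edge_elt m e \<otimes>\<^bsub>W m\<^esub> x) (the_maximal_dyck_path a b) \<one>\<^bsub>W m\<^esub>"

end

theory Submission
  imports Defs
begin

text \<open>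
  Let \<open>x = s\<^sub>2 s\<^sub>3\<close> and \<open>y = s\<^sub>2 s\<^sub>1\<close>.  These rotations have order \<open>m\<close> and generate a free
  product of two cyclic groups of order \<open>m\<close> in \<open>W(m)\<close> (\<open>independent_pair_rotations\<close>), and \<open>s\<^sup>a\<^sup>\<times>\<^sup>b\<close> is the Christoffel
  word of slope \<open>b / a\<close> evaluated at \<open>x\<close> and \<open>y\<close> (\<open>s_dyck_christoffel\<close>).  If the horizontal runs
  of the path are shorter than \<open>m\<close>, this is a normal form in the free product and the path can be
  read off.  A run of length \<open>m\<close>, however, disappears, so that the normal form is not visible for
  \<open>a / b\<close> close to \<open>m\<close>.

  The way out is that simple reflections act on these products.  Write \<open>E(p, q; a, b)\<close> for the word
  of \<open>(a, b)\<close> with horizontal letter \<open>p\<close> and vertical letter \<open>q\<close>.  If \<open>p\<^sup>m = 1\<close> and \<open>a < m b\<close>, then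
  \<open>E(p, q; a, b) = q\<^sup>-\<^sup>1 E(q, p\<^sup>-\<^sup>1; b, m b - a) q\<close> (\<open>christoffel_reflect\<close>).  Here
  \<open>(b, m b - a)\<close> is a reflected root with its coordinates exchanged, and \<open>(q, p\<^sup>-\<^sup>1)\<close> is again a pair
  of free generators.  An induction with this identity shows that \<open>E(p, q; a, b) = v p\<^sup>r q\<close> where the
  normal form of \<open>v\<close> does not end in a power of \<open>p\<close>, and where \<open>0 \<le> r < m\<close> reveals the range of
  \<open>a / b\<close>: it is \<open>0\<close> iff \<open>a = m b\<close>, it is \<open>m - 1\<close> iff \<open>(m - 1) b \<le> a < m b\<close>, and it lies strictly
  between in the remaining case \<open>a < (m - 1) b\<close> (\<open>christoffel_normal_form\<close>).

  Hence two roots with the same product lie in the same range.  In the first range there is only the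
  root \<open>(m, 1)\<close>; in the second one the reflected roots have equal products as well, and they are
  smaller, except that \<open>(1, 1)\<close> is its own image for \<open>m = 2\<close>; in the third one the words are normal forms (\<open>christoffel_inj\<close>).
\<close>

section \<open>Staircase products and simple reflections\<close>

lemma le_int_div_iff:
  fixes a b c :: int
  assumes "0 < b"
  shows "c \<le> a div b \<longleftrightarrow> c * b \<le> a"
proof
  assume "c \<le> a div b"
  then have "c * b \<le> a div b * b" using assms by simp
  also have "\<dots> = a - a mod b" by (simp add: minus_mod_eq_div_mult)
  also have "\<dots> \<le> a" using assms by simp
  finally show "c * b \<le> a" .
next
  assume "c * b \<le> a"
  then have "c * b div b \<le> a div b" using assms by (rule zdiv_mono1)
  then show "c \<le> a div b" using assms by simp
qed

definition ceil_div :: "int \<Rightarrow> int \<Rightarrow> int" where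
  "ceil_div a b = - ((- a) div b)"

lemma ceil_div_le_iff: "0 < b \<Longrightarrow> ceil_div a b \<le> c \<longleftrightarrow> a \<le> c * b"
proof -
  assume b: "0 < b"
  have "ceil_div a b \<le> c \<longleftrightarrow> - c \<le> (- a) div b" by (auto simp: ceil_div_def)
  also have "\<dots> \<longleftrightarrow> - c * b \<le> - a" using b by (rule le_int_div_iff)
  finally show ?thesis by simp
qed

lemma ceil_div_unique:
  assumes "0 < b" "(c - 1) * b < a" "a \<le> c * b"
  shows "ceil_div a b = c"
  using assms ceil_div_le_iff[of b a c] ceil_div_le_iff[of b a "c - 1"] by linarith

lemma ceil_div_0 [simp]: "ceil_div 0 b = 0"
  by (simp add: ceil_div_def)

lemma ceil_div_mult: "0 < b \<Longrightarrow> ceil_div (a * b) b = a"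
  by (rule ceil_div_unique) (auto simp: algebra_simps)

context group
begin

text \<open>
  The product along the lattice path with \<open>n\<close> vertical edges whose \<open>j\<close>-th vertical edge is preceded
  by \<open>c j - c 0\<close> horizontal ones, for horizontal letter \<open>p\<close> and vertical letter \<open>q\<close>.  Integer
  exponents make the product meaningful for every \<open>c\<close>, as is needed when the exponents are
  changed modulo \<open>m\<close> in \<open>staircase_complement\<close>.
\<close>

primrec staircase :: "'a \<Rightarrow> 'a \<Rightarrow> (nat \<Rightarrow> int) \<Rightarrow> nat \<Rightarrow> 'a" where
  "staircase p q c 0 = \<one>"
| "staircase p q c (Suc n) = staircase p q c n \<otimes> p [^] (c (Suc n) - c n) \<otimes> q"

lemma staircase_closed [simp, intro]:
  "p \<in> carrier G \<Longrightarrow> q \<in> carrier G \<Longrightarrow> staircase p q c n \<in> carrier G"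
  by (induction n) auto

text \<open>
  The Christoffel word of slope \<open>b / a\<close> evaluated at \<open>p\<close> and \<open>q\<close>: the highest path under the
  diagonal can make its \<open>j\<close>-th up step as soon as its abscissa \<open>x\<close> satisfies \<open>a j \<le> b x\<close>.
\<close>

definition christoffel :: "'a \<Rightarrow> 'a \<Rightarrow> int \<Rightarrow> int \<Rightarrow> 'a" where
  "christoffel p q a b = staircase p q (\<lambda>j. ceil_div (a * int j) b) (nat b)"

lemma staircase_complement:
  assumes "p \<in> carrier G" "q \<in> carrier G" and m: "p [^] (m::int) = \<one>"
  shows "staircase p q (\<lambda>j. m * int j - f j) n = staircase (inv p) q f n"
proof (induction n)
  case (Suc n)
  have "m * int (Suc n) - f (Suc n) - (m * int n - f n) = m + - (f (Suc n) - f n)"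
    by (simp add: algebra_simps)
  then have "p [^] (m * int (Suc n) - f (Suc n) - (m * int n - f n))
      = p [^] m \<otimes> p [^] (- (f (Suc n) - f n))"
    using assms(1) by (simp only: int_pow_mult)
  also have "\<dots> = (inv p) [^] (f (Suc n) - f n)"
    using assms(1) by (simp add: m int_pow_neg int_pow_inv del: minus_diff_eq)
  finally show ?case using Suc by simp
qed simp

text \<open>
  One tread of the dual staircase: on a range where \<open>d\<close> is constantly \<open>s\<close>, all powers of \<open>q\<close> after
  the first are trivial, so the factors \<open>p\<close> are consecutive.
\<close>

lemma staircase_flat:
  assumes "p \<in> carrier G" "q \<in> carrier G"
    and "\<And>l. i < l \<Longrightarrow> l \<le> i + k \<Longrightarrow> d l = s"
  shows "staircase q p d i \<otimes> q [^] (s - d i) \<otimes> p [^] k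
       = staircase q p d (i + k) \<otimes> q [^] (s - d (i + k))"
  using assms(3)
proof (induction k)
  case 0
  then show ?case using assms by simp
next
  case (Suc k)
  have IH: "staircase q p d i \<otimes> q [^] (s - d i) \<otimes> p [^] k
       = staircase q p d (i + k) \<otimes> q [^] (s - d (i + k))"
    using Suc by simp
  have s: "d (Suc (i + k)) = s" using Suc.prems[of "Suc (i + k)"] by simp
  have "staircase q p d i \<otimes> q [^] (s - d i) \<otimes> p [^] Suc k
      = staircase q p d i \<otimes> q [^] (s - d i) \<otimes> p [^] k \<otimes> p"
    using assms by (simp add: m_assoc)
  then show ?case using assms(1,2) by (simp add: IH s)
qed

text \<open>
  A lattice path can be cut after its \<open>q\<close>-edges or after its \<open>p\<close>-edges.  In the product for \<open>f\<close>, the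
  \<open>i\<close>-th \<open>p\<close>-edge belongs to the first block \<open>j\<close> with \<open>b i \<le> a j\<close>, so it lies at height
  \<open>\<lceil>b i / a\<rceil> - 1\<close>.  An extra \<open>q\<close> in front lifts it to the height \<open>\<lceil>b i / a\<rceil>\<close> that \<open>d\<close>
  prescribes; cutting after the \<open>p\<close>-edges gives the product for \<open>d\<close>, up to the \<open>q\<close>-edges after the
  last \<open>p\<close>.
\<close>

lemma staircase_dual:
  assumes pq: "p \<in> carrier G" "q \<in> carrier G" and pos: "0 < a" "0 < b"
  defines "f \<equiv> \<lambda>n. a * int n div b" and "d \<equiv> \<lambda>i. ceil_div (b * int i) a"
  shows "q \<otimes> staircase p q f n
       = staircase q p d (nat (f n)) \<otimes> q [^] (int n + 1 - d (nat (f n)))"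
proof (induction n)
  case 0
  then show ?case using pq by (simp add: f_def d_def)
next
  case (Suc n)
  have f0: "0 \<le> f n" for n using pos by (simp add: f_def pos_imp_zdiv_nonneg_iff)
  have mono: "f n \<le> f (Suc n)" using pos by (auto simp: f_def intro!: zdiv_mono1)
  define k where "k = nat (f (Suc n)) - nat (f n)"
  have k: "nat (f (Suc n)) = nat (f n) + k" "f (Suc n) - f n = int k"
    using f0 mono by (auto simp: k_def)
  \<comment> \<open>once lifted, the \<open>p\<close>-edges of the block added in this step lie at height \<open>n + 1\<close>\<close>
  have dval: "d l = int n + 1" if "nat (f n) < l" "l \<le> nat (f n) + k" for l
  proof -
    have "f n < int l" "int l \<le> f (Suc n)" using that k f0[of n] f0[of "Suc n"] by auto
    then have "a * int n < int l * b" "int l * b \<le> a * int (Suc n)"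
      using le_int_div_iff[OF pos(2), of "int l"]
      by (auto simp: f_def simp flip: not_le)
    then show ?thesis unfolding d_def
      by (intro ceil_div_unique) (use pos in \<open>auto simp: algebra_simps\<close>)
  qed
  have "q \<otimes> staircase p q f (Suc n) = q \<otimes> staircase p q f n \<otimes> p [^] k \<otimes> q"
    using pq by (simp add: k(2) int_pow_int m_assoc)
  also have "q \<otimes> staircase p q f n \<otimes> p [^] k =
      staircase q p d (nat (f (Suc n))) \<otimes> q [^] (int n + 1 - d (nat (f (Suc n))))"
    unfolding Suc.IH k(1) using pq dval by (rule staircase_flat)
  also have "\<dots> \<otimes> q = staircase q p d (nat (f (Suc n)))
      \<otimes> (q [^] (int n + 1 - d (nat (f (Suc n)))) \<otimes> q [^] (1::int))"
    using pq by (simp add: m_assoc int_pow_1)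
  also have "q [^] (int n + 1 - d (nat (f (Suc n)))) \<otimes> q [^] (1::int)
      = q [^] (int (Suc n) + 1 - d (nat (f (Suc n))))"
    using pq by (simp add: int_pow_mult[symmetric] algebra_simps del: int_pow_1)
  finally show ?case .
qed

text \<open>
  The effect of a simple reflection.  With \<open>a' = m b - a\<close>, the number of \<open>p\<close>-edges before the
  \<open>j\<close>-th \<open>q\<close>-edge is \<open>\<lceil>a j / b\<rceil> = m j - \<lfloor>a' j / b\<rfloor>\<close>, so modulo \<open>p\<^sup>m = 1\<close> the product is one in
  \<open>p\<^sup>-\<^sup>1\<close> and \<open>q\<close> along the path for \<open>\<lfloor>a' j / b\<rfloor>\<close>.  That path is dual to the Christoffel path
  of \<open>(b, a')\<close>, except that a letter \<open>q\<close> sits at the end instead of the beginning; this is the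
  conjugation by \<open>q\<close>.
\<close>

lemma christoffel_reflect:
  assumes pq: "p \<in> carrier G" "q \<in> carrier G" and m: "p [^] (m::int) = \<one>"
    and "0 < b" "a < m * b"
  shows "christoffel p q a b = inv q \<otimes> christoffel q (inv p) b (m * b - a) \<otimes> q"
proof -
  let ?a = "m * b - a"
  have "ceil_div (a * int j) b = m * int j - ?a * int j div b" for j
  proof -
    have "- (a * int j) = ?a * int j + (- m * int j) * b" by (simp add: algebra_simps)
    then have "(- (a * int j)) div b = - m * int j + ?a * int j div b"
      using \<open>0 < b\<close> by (simp only: div_mult_self1)
    then show ?thesis by (simp add: ceil_div_def)
  qed
  then have eq: "christoffel p q a b = staircase (inv p) q (\<lambda>j. ?a * int j div b) (nat b)"
    using staircase_complement[OF pq m] by (simp add: christoffel_def)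
  have "q \<otimes> christoffel p q a b = christoffel q (inv p) b ?a \<otimes> q"
    using staircase_dual[of "inv p" q ?a b "nat b"] pq assms(4,5) ceil_div_mult[of ?a b]
    unfolding eq by (simp add: christoffel_def)
  moreover have "christoffel p q a b \<in> carrier G" "christoffel q (inv p) b ?a \<in> carrier G"
    using pq by (auto simp: christoffel_def)
  ultimately show ?thesis using pq
    by (metis inv_solve_left m_assoc inv_closed m_closed)
qed

end

section \<open>Free pairs of generators\<close>

context group
begin

text \<open>
  A convenient form of the statement that \<open>p\<close> and \<open>q\<close> generate the free product of two cyclic groups
  of order \<open>m\<close>.  The set \<open>P\<close> plays the role of the elements whose normal form does not end in a power
  of \<open>p\<close>, and \<open>Q\<close> that of the elements whose normal form does not end in a power of \<open>q\<close>.  Phrased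
  with such sets, the condition passes from \<open>(p, q)\<close> to the pair \<open>(q, p\<^sup>-\<^sup>1)\<close> of
  \<open>christoffel_reflect\<close> by exchanging the two sets.
\<close>

definition independent_pair :: "int \<Rightarrow> 'a \<Rightarrow> 'a \<Rightarrow> 'a set \<Rightarrow> 'a set \<Rightarrow> bool" where
  "independent_pair m p q P Q \<longleftrightarrow>
     p \<in> carrier G \<and> q \<in> carrier G \<and> p [^] m = \<one> \<and> q [^] m = \<one> \<and>
     P \<subseteq> carrier G \<and> Q \<subseteq> carrier G \<and> \<one> \<in> P \<and> \<one> \<in> Q \<and>
     (\<forall>g\<in>P. \<forall>i. 0 < i \<and> i < m \<longrightarrow> g \<otimes> p [^] i \<in> Q - P) \<and>
     (\<forall>g\<in>Q. \<forall>i. 0 < i \<and> i < m \<longrightarrow> g \<otimes> q [^] i \<in> P - Q) \<and>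
     (\<forall>g\<in>P. \<forall>i. q [^] (i::int) \<otimes> g \<in> P) \<and> (\<forall>g\<in>Q. \<forall>i. p [^] (i::int) \<otimes> g \<in> Q)"

lemma independent_pairD:
  assumes "independent_pair m p q P Q"
  shows "g \<in> P \<Longrightarrow> 0 < i \<Longrightarrow> i < m \<Longrightarrow> g \<otimes> p [^] i \<in> Q - P"
    and "g \<in> Q \<Longrightarrow> 0 < i \<Longrightarrow> i < m \<Longrightarrow> g \<otimes> q [^] i \<in> P - Q"
    and "g \<in> P \<Longrightarrow> q [^] (j::int) \<otimes> g \<in> P"
  using assms by (auto simp: independent_pair_def)

lemma independent_pair_right_mult:
  assumes "independent_pair m p q P Q" "2 \<le> m" "g \<in> Q"
  shows "g \<otimes> q \<in> P - Q"
  using independent_pairD(2)[OF assms(1,3), of 1] assms by (simp add: independent_pair_def)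

lemma independent_pair_left_inv:
  assumes "independent_pair m p q P Q" "g \<in> P"
  shows "inv q \<otimes> g \<in> P"
  using independent_pairD(3)[OF assms, of "- 1"] assms(1)
  by (simp add: independent_pair_def int_pow_neg)

lemma inv_int_pow_period:
  assumes "p \<in> carrier G" "p [^] (m::int) = \<one>"
  shows "inv p [^] i = p [^] (m - i)"
proof -
  have "p [^] (m - i) = p [^] m \<otimes> p [^] (- i)"
    using assms(1) by (simp only: diff_conv_add_uminus int_pow_mult)
  then show ?thesis using assms by (simp add: int_pow_neg int_pow_inv)
qed

lemma independent_pair_rotate:
  assumes "independent_pair m p q P Q"
  shows "independent_pair m q (inv p) Q P"
  using assms inv_int_pow_period[of p m]
  unfolding independent_pair_def
  by (auto simp: Ball_def)

lemma independent_pair_inv: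
  assumes "independent_pair m p q P Q" "2 \<le> m" "g \<in> P"
  shows "g \<otimes> inv p \<in> Q - P"
proof -
  have "inv p = p [^] (m - 1)"
    using assms(1) inv_int_pow_period[of p m 1] by (simp add: independent_pair_def)
  then show ?thesis using assms by (simp add: independent_pair_def)
qed

lemma staircase_mem:
  assumes ind: "independent_pair m p q P Q" and m: "2 \<le> m"
    and "\<And>j. j < n \<Longrightarrow> 0 < c (Suc j) - c j \<and> c (Suc j) - c j < m"
  shows "staircase p q c n \<in> P"
  using assms(3)
proof (induction n)
  case 0
  then show ?case using ind by (simp add: independent_pair_def)
next
  case (Suc n)
  then have "staircase p q c n \<otimes> p [^] (c (Suc n) - c n) \<in> Q"
    using independent_pairD(1)[OF ind] by auto
  then show ?case using independent_pair_right_mult[OF ind m] by auto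
qed

text \<open>
  The last power of \<open>p\<close> is determined by the element: if \<open>i < j\<close>, then \<open>g = h p\<^sup>j\<^sup>-\<^sup>i\<close> would both
  lie in \<open>P\<close> and end in a power of \<open>p\<close>.
\<close>

lemma independent_pair_cancel:
  assumes ind: "independent_pair m p q P Q" and "g \<in> P" "h \<in> P"
    and i: "0 \<le> i" "i < m" and j: "0 \<le> j" "j < m" and eq: "g \<otimes> p [^] i = h \<otimes> p [^] j"
  shows "i = j \<and> g = h"
proof -
  have aux: "\<not> i < j" if "g \<in> P" "h \<in> P" "0 \<le> i" "j < m" "g \<otimes> p [^] i = h \<otimes> p [^] j" for g h i j
  proof
    assume "i < j"
    have c: "g \<in> carrier G" "h \<in> carrier G" "p \<in> carrier G"
      using ind that by (auto simp: independent_pair_def)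
    have "h \<otimes> p [^] (j - i) \<otimes> p [^] i = h \<otimes> p [^] j"
      using c by (simp add: m_assoc int_pow_mult[symmetric])
    then have "g = h \<otimes> p [^] (j - i)" using c that(5) by (metis right_cancel int_pow_closed m_closed)
    moreover have "h \<otimes> p [^] (j - i) \<notin> P"
      using ind that \<open>i < j\<close> by (simp add: independent_pair_def)
    ultimately show False using that by simp
  qed
  have "i = j" using aux[of g h i j] aux[of h g j i] assms by (metis linorder_neqE)
  moreover have "g \<in> carrier G" "h \<in> carrier G" "p \<in> carrier G"
    using assms by (auto simp: independent_pair_def)
  ultimately show ?thesis using eq by simp
qed

text \<open>
  If all treads have length strictly between \<open>0\<close> and \<open>m\<close>, the product is a normal form, and the path
  is recovered from its end by \<open>independent_pair_cancel\<close>.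
\<close>

lemma staircase_eqD:
  assumes ind: "independent_pair m p q P Q" and m: "2 \<le> m"
    and "\<And>j. j < n \<Longrightarrow> 0 < c (Suc j) - c j \<and> c (Suc j) - c j < m"
    and "\<And>j. j < n' \<Longrightarrow> 0 < c' (Suc j) - c' j \<and> c' (Suc j) - c' j < m"
    and "c 0 = c' 0"
    and "staircase p q c n = staircase p q c' n'"
  shows "n = n' \<and> c n = c' n'"
  using assms(3,4,6)
proof (induction n arbitrary: n')
  have pq: "p \<in> carrier G" "q \<in> carrier G" using ind by (auto simp: independent_pair_def)
  have nontrivial: "staircase p q c (Suc n) \<noteq> \<one>"
    if "\<And>j. j < Suc n \<Longrightarrow> 0 < c (Suc j) - c j \<and> c (Suc j) - c j < m" for c n
  proof
    assume one: "staircase p q c (Suc n) = \<one>"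
    have "staircase p q c n \<in> P" using ind m that by (intro staircase_mem) auto
    then have "staircase p q c n \<otimes> p [^] (c (Suc n) - c n) \<in> Q"
      using independent_pairD(1)[OF ind] that[of n] by auto
    then have "staircase p q c (Suc n) \<notin> Q"
      using independent_pair_right_mult[OF ind m] by auto
    then show False using one ind by (simp add: independent_pair_def)
  qed
  {
    case 0
    then show ?case using nontrivial[of "n' - 1" c'] \<open>c 0 = c' 0\<close> by (cases n') auto
  next
    case (Suc n)
    obtain k where k: "n' = Suc k"
      using nontrivial[of n c] Suc.prems(1,3) by (cases n') auto
    have "staircase p q c n \<otimes> p [^] (c (Suc n) - c n) = staircase p q c' k \<otimes> p [^] (c' (Suc k) - c' k)"
      using Suc.prems(3) pq by (simp add: k)
    moreover have "staircase p q c n \<in> P" "staircase p q c' k \<in> P"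
      using Suc.prems(1,2) k by (auto intro!: staircase_mem[OF ind m])
    ultimately have "c (Suc n) - c n = c' (Suc k) - c' k" "staircase p q c n = staircase p q c' k"
      using independent_pair_cancel[OF ind] Suc.prems(1)[of n] Suc.prems(2)[of k] k
      by (metis lessI less_imp_le)+
    moreover have "n = k \<and> c n = c' k"
      using Suc.prems(1,2) k calculation(2) by (intro Suc.IH) auto
    ultimately show ?case unfolding k by auto
  }
qed

end

section \<open>Christoffel products of free generators\<close>

text \<open>
  The reduced positive roots \<open>[a, b]\<close> with \<open>a \<ge> b\<close>, in terms of the quadratic form.
\<close>

definition wide_root :: "int \<Rightarrow> int \<Rightarrow> int \<Rightarrow> bool" where
  "wide_root m a b \<longleftrightarrow> 0 < b \<and> b \<le> a \<and> coprime a b \<and> a\<^sup>2 + b\<^sup>2 - m * a * b \<le> 1"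

lemma wide_root_le:
  assumes "wide_root m a b"
  shows "a \<le> m * b"
proof (rule ccontr)
  assume "\<not> a \<le> m * b"
  then have "a * (a - m * b) \<ge> 1 * 1" using assms by (intro mult_mono) (auto simp: wide_root_def)
  moreover have "b\<^sup>2 > 0" using assms by (simp add: wide_root_def)
  ultimately show False using assms by (simp add: wide_root_def power2_eq_square algebra_simps)
qed

lemma wide_root_eq:
  assumes "wide_root m a b" "a = m * b"
  shows "b = 1"
  using assms by (auto simp: wide_root_def)

text \<open>
  A simple reflection followed by the exchange of coordinates preserves the quadratic form; the bound
  \<open>(m - 1) b \<le> a\<close> says that the result again has its larger coordinate first.
\<close>

lemma wide_root_reflect:
  assumes "wide_root m a b" "(m - 1) * b \<le> a" "a < m * b"
  shows "wide_root m b (m * b - a)"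
proof -
  have "coprime b (m * b - a)"
  proof (rule coprimeI)
    fix d assume "d dvd b" "d dvd m * b - a"
    then have "d dvd m * b - (m * b - a)" by (meson dvd_diff dvd_mult)
    then have "d dvd a" by simp
    then show "is_unit d" using assms(1) \<open>d dvd b\<close>
      by (auto simp: wide_root_def dest: coprime_common_divisor)
  qed
  then show ?thesis using assms
    by (simp add: wide_root_def power2_eq_square algebra_simps)
qed

lemma ceil_div_step:
  assumes b: "0 < b" and le: "b \<le> a" and m: "a \<le> n * b"
  shows "0 < ceil_div (a * int (Suc j)) b - ceil_div (a * int j) b
       \<and> ceil_div (a * int (Suc j)) b - ceil_div (a * int j) b \<le> n"
proof -
  let ?c = "ceil_div (a * int j) b" and ?c' = "ceil_div (a * int (Suc j)) b"
  have c: "a * int j \<le> ?c * b" and c': "a * int (Suc j) \<le> ?c' * b"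
    using ceil_div_le_iff[OF b] by blast+
  have "a * int (Suc j) \<le> (?c + n) * b" using c m by (simp add: algebra_simps)
  then have "?c' \<le> ?c + n" using ceil_div_le_iff[OF b] by blast
  moreover have "a * int j \<le> (?c' - 1) * b" using c' le by (simp add: algebra_simps)
  then have "?c \<le> ?c' - 1" using ceil_div_le_iff[OF b] by blast
  ultimately show ?thesis by simp
qed

lemma ceil_div_last_step:
  assumes b: "0 < b" and m: "a < n * b"
  shows "a - ceil_div (a * (b - 1)) b < n"
proof -
  let ?c = "ceil_div (a * (b - 1)) b"
  have c: "a * (b - 1) \<le> ?c * b"
    using ceil_div_le_iff[OF b] by blast
  then have "(a - ?c) * b \<le> a" by (simp add: algebra_simps)
  then have "(a - ?c) * b < n * b" using m by simp
  then show ?thesis using b by simp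
qed

context group
begin

text \<open>
  For \<open>a \<le> (m - 1) b\<close> every tread is shorter than \<open>m\<close>, so no reduction modulo \<open>p\<^sup>m = 1\<close>
  takes place, and the last tread has length \<open>r = \<lfloor>a / b\<rfloor>\<close>.
\<close>

lemma christoffel_direct:
  assumes ind: "independent_pair m p q P Q" and m: "2 \<le> m"
    and root: "wide_root m a b" and lt: "a \<le> (m - 1) * b"
  obtains v r where "v \<in> P" "0 < r" "r < m" "a < (m - 1) * b \<Longrightarrow> r < m - 1"
    "christoffel p q a b = v \<otimes> p [^] r \<otimes> q"
proof -
  let ?c = "\<lambda>j. ceil_div (a * int j) b"
  have b: "0 < b" "b \<le> a" using root by (auto simp: wide_root_def)
  have step: "0 < ?c (Suc j) - ?c j \<and> ?c (Suc j) - ?c j < m" for j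
    using ceil_div_step[OF b lt, of j] by simp
  define k where "k = nat b - 1"
  have k: "nat b = Suc k" "int k = b - 1" using b by (auto simp: k_def)
  have last: "?c (Suc k) = a" using ceil_div_mult[of b a] b(1) k by simp
  show thesis
  proof (rule that)
    show "staircase p q ?c k \<in> P" using step by (intro staircase_mem[OF ind m]) auto
    show "0 < ?c (Suc k) - ?c k" "?c (Suc k) - ?c k < m" using step by auto
    show "?c (Suc k) - ?c k < m - 1" if "a < (m - 1) * b"
      unfolding last using ceil_div_last_step[OF b(1) that] by (simp add: k)
    show "christoffel p q a b = staircase p q ?c k \<otimes> p [^] (?c (Suc k) - ?c k) \<otimes> q"
      by (simp add: christoffel_def k(1))
  qed
qed

lemma christoffel_extreme:
  assumes "p \<in> carrier G" "q \<in> carrier G" "p [^] m = \<one>" "wide_root m a b" "a = m * b"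
  shows "christoffel p q a b = q"
  using assms wide_root_eq[of m a b] by (simp add: christoffel_def ceil_div_def)

text \<open>
  The product ends in exactly one letter \<open>q\<close>.  For large \<open>a / b\<close> this is inherited along the
  reflection: the reflected product ends in exactly one \<open>p\<^sup>-\<^sup>1\<close>, a left factor \<open>q\<^sup>-\<^sup>1\<close> cannot
  create a final power of \<open>p\<close> in front of it, and the conjugation appends a \<open>q\<close>.  The reflection
  is used only for \<open>(m - 1) b < a\<close>, where it decreases the first coordinate; for \<open>m = 2\<close> it would
  fix \<open>(1, 1)\<close>.
\<close>

lemma christoffel_ends:
  assumes "independent_pair m p q P Q" and m: "2 \<le> m" and "wide_root m a b"
  shows "\<exists>u\<in>Q. christoffel p q a b = u \<otimes> q"
  using assms(1,3)
proof (induction "nat a" arbitrary: p q P Q a b rule: less_induct)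
  case less
  note ind = less.prems(1) and root = less.prems(2)
  have pq: "p \<in> carrier G" "q \<in> carrier G" "p [^] m = \<one>" "P \<subseteq> carrier G" "Q \<subseteq> carrier G" "\<one> \<in> Q"
    using ind by (auto simp: independent_pair_def)
  consider "a \<le> (m - 1) * b" | "(m - 1) * b < a" "a < m * b" | "a = m * b"
    using wide_root_le[OF root] by linarith
  then show ?case
  proof cases
    case 1
    obtain v r where "v \<in> P" "0 < r" "r < m" "christoffel p q a b = v \<otimes> p [^] r \<otimes> q"
      using christoffel_direct[OF ind m root 1] by blast
    moreover have "v \<otimes> p [^] r \<in> Q" using ind calculation by (simp add: independent_pair_def)
    ultimately show ?thesis by blast
  next
    case 2
    let ?E = "christoffel q (inv p) b (m * b - a)"
    have "b < a"
    proof -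
      have "1 * b \<le> (m - 1) * b" using m root by (intro mult_right_mono) (auto simp: wide_root_def)
      then show ?thesis using 2 by simp
    qed
    then obtain u where u: "u \<in> P" "?E = u \<otimes> inv p"
      using less.hyps[OF _ independent_pair_rotate[OF ind] wide_root_reflect[OF root]] 2 root
      by (auto simp: wide_root_def)
    have "inv q \<otimes> u \<in> P"
      using independent_pair_left_inv[OF ind u(1)] .
    then have "inv q \<otimes> u \<otimes> inv p \<in> Q" using independent_pair_inv[OF ind m] by blast
    moreover have "christoffel p q a b = inv q \<otimes> u \<otimes> inv p \<otimes> q"
      using christoffel_reflect[OF pq(1-3), of b a] root 2 u pq
      by (auto simp: wide_root_def m_assoc subset_iff)
    ultimately show ?thesis by blast
  next
    case 3
    then have "christoffel p q a b = \<one> \<otimes> q"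
      using christoffel_extreme[OF pq(1-3) root] pq by simp
    then show ?thesis using pq by blast
  qed
qed

lemma christoffel_steep:
  assumes ind: "independent_pair m p q P Q" and m: "2 \<le> m"
    and root: "wide_root m a b" and "(m - 1) * b \<le> a" "a < m * b"
  shows "\<exists>v\<in>P. christoffel p q a b = v \<otimes> p [^] (m - 1) \<otimes> q"
proof -
  have pq: "p \<in> carrier G" "q \<in> carrier G" "p [^] m = \<one>" "P \<subseteq> carrier G"
    using ind by (auto simp: independent_pair_def)
  obtain u where u: "u \<in> P" "christoffel q (inv p) b (m * b - a) = u \<otimes> inv p"
    using christoffel_ends[OF independent_pair_rotate[OF ind] m wide_root_reflect[OF root assms(4,5)]]
    by blast
  have "inv q \<otimes> u \<in> P"
    using independent_pair_left_inv[OF ind u(1)] .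
  moreover have "inv p = p [^] (m - 1)" using inv_int_pow_period[of p m 1] pq by simp
  then have "christoffel p q a b = inv q \<otimes> u \<otimes> p [^] (m - 1) \<otimes> q"
    using christoffel_reflect[OF pq(1-3), of b a] root assms(5) u pq
    by (auto simp: wide_root_def m_assoc subset_iff)
  ultimately show ?thesis by blast
qed

text \<open>
  The exponent \<open>r\<close> of the last \<open>p\<close>-syllable, read modulo \<open>m\<close>, tells in which of three ranges the
  ratio \<open>a / b\<close> lies.  The value \<open>m - 1\<close>, that is a final \<open>p\<^sup>-\<^sup>1 q\<close>, is the trace of a reflection.
\<close>

lemma christoffel_normal_form:
  assumes ind: "independent_pair m p q P Q" and m: "2 \<le> m" and root: "wide_root m a b"
  obtains v r where "v \<in> P" "0 \<le> r" "r < m" "christoffel p q a b = v \<otimes> p [^] r \<otimes> q"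
    "r = 0 \<longleftrightarrow> a = m * b" "r = m - 1 \<longleftrightarrow> (m - 1) * b \<le> a \<and> a < m * b"
proof -
  have pq: "p \<in> carrier G" "q \<in> carrier G" "p [^] m = \<one>" "\<one> \<in> P"
    using ind by (auto simp: independent_pair_def)
  have b: "0 < b" using root by (simp add: wide_root_def)
  then have mb: "(m - 1) * b < m * b" by simp
  consider "a < (m - 1) * b" | "(m - 1) * b \<le> a" "a < m * b" | "a = m * b"
    using wide_root_le[OF root] by linarith
  then show thesis
  proof cases
    case 1
    then obtain v r where "v \<in> P" "0 < r" "r < m - 1" "christoffel p q a b = v \<otimes> p [^] r \<otimes> q"
      using christoffel_direct[OF ind m root] by (metis less_imp_le)
    then show ?thesis using that[of v r] 1 mb by simp
  next
    case 2
    then obtain v where "v \<in> P" "christoffel p q a b = v \<otimes> p [^] (m - 1) \<otimes> q"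
      using christoffel_steep[OF ind m root] by blast
    then show ?thesis using that[of v "m - 1"] 2 m by auto
  next
    case 3
    then show ?thesis using that[of \<one> 0] christoffel_extreme[OF pq(1-3) root 3] pq m mb by auto
  qed
qed

text \<open>
  Equal products have the same last exponent \<open>r\<close>, hence ratios in the same range.  If \<open>r = 0\<close>, both
  roots are \<open>(m, 1)\<close>.  If \<open>r = m - 1\<close>, both products are conjugates by the same \<open>q\<close> of the products
  of the reflected roots, to which induction applies.  Otherwise both products are normal forms and
  are compared letter by letter.
\<close>

lemma christoffel_inj:
  assumes "independent_pair m p q P Q" and m: "2 \<le> m"
    and "wide_root m a b" "wide_root m c d"
    and "christoffel p q a b = christoffel p q c d"
  shows "a = c \<and> b = d"
  using assms(1,3-)
proof (induction "nat (a + b + c + d)" arbitrary: p q P Q a b c d rule: less_induct)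
  case less
  note ind = less.prems(1) and ab = less.prems(2) and cd = less.prems(3) and eq = less.prems(4)
  have pq: "p \<in> carrier G" "q \<in> carrier G" "p [^] m = \<one>" "P \<subseteq> carrier G"
    using ind by (auto simp: independent_pair_def)
  have pos: "0 < b" "b \<le> a" "0 < d" "d \<le> c" using ab cd by (auto simp: wide_root_def)
  obtain v r where v: "v \<in> P" "0 \<le> r" "r < m" "christoffel p q a b = v \<otimes> p [^] r \<otimes> q"
    and r: "r = 0 \<longleftrightarrow> a = m * b" "r = m - 1 \<longleftrightarrow> (m - 1) * b \<le> a \<and> a < m * b"
    using christoffel_normal_form[OF ind m ab] by blast
  obtain v' r' where v': "v' \<in> P" "0 \<le> r'" "r' < m" "christoffel p q c d = v' \<otimes> p [^] r' \<otimes> q"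
    and r': "r' = 0 \<longleftrightarrow> c = m * d" "r' = m - 1 \<longleftrightarrow> (m - 1) * d \<le> c \<and> c < m * d"
    using christoffel_normal_form[OF ind m cd] by blast
  have "v \<otimes> p [^] r = v' \<otimes> p [^] r'"
  proof -
    have "v \<in> carrier G" "v' \<in> carrier G" using v(1) v'(1) pq(4) by auto
    then show ?thesis using eq v(4) v'(4) pq by simp
  qed
  then have rr: "r = r'"
    using independent_pair_cancel[OF ind v(1) v'(1) v(2,3) v'(2,3)] by simp
  consider "r = 0" | "r = m - 1" | "r \<noteq> 0" "r \<noteq> m - 1" by blast
  then show ?case
  proof cases
    case 1
    then have "a = m * b" "c = m * d" using r r' rr by auto
    then show ?thesis using wide_root_eq ab cd by metis
  next
    case 2
    then have A: "(m - 1) * b \<le> a" "a < m * b" and C: "(m - 1) * d \<le> c" "c < m * d"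
      using r r' rr by auto
    let ?E = "christoffel q (inv p) b (m * b - a)" and ?F = "christoffel q (inv p) d (m * d - c)"
    have "?E \<in> carrier G" "?F \<in> carrier G" using pq by (auto simp: christoffel_def)
    then have EF: "?E = ?F"
      using eq christoffel_reflect[OF pq(1-3) pos(1) A(2)] christoffel_reflect[OF pq(1-3) pos(3) C(2)] pq
      by (simp add: m_assoc)
    \<comment> \<open>the reflection decreases the sum of the coordinates, except that it fixes \<open>(1, 1)\<close> when \<open>m = 2\<close>\<close>
    have dec: "m * y \<le> 2 * x \<and> (m * y = 2 * x \<longrightarrow> x = y)"
      if "(m - 1) * y \<le> x" "0 < y" "y \<le> x" for x y
    proof (cases "m = 2")
      case False
      then have "0 < (m - 2) * y" using m that by simp
      moreover have "2 * ((m - 1) * y) = m * y + (m - 2) * y" by (simp add: algebra_simps)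
      ultimately show ?thesis using that(1) by simp
    qed (use that in auto)
    show ?thesis
    proof (cases "m * b = 2 * a \<and> m * d = 2 * c")
      case True
      then have "a = b" "c = d" using dec[OF A(1) pos(1,2)] dec[OF C(1) pos(3,4)] by auto
      then show ?thesis using ab cd pos by (auto simp: wide_root_def)
    next
      case False
      moreover have "m * b \<le> 2 * a" "m * d \<le> 2 * c"
        using dec[OF A(1) pos(1,2)] dec[OF C(1) pos(3,4)] by simp_all
      ultimately have "m * b < 2 * a \<or> m * d < 2 * c" by (metis order_le_less)
      with \<open>m * b \<le> 2 * a\<close> \<open>m * d \<le> 2 * c\<close> have "b + (m * b - a) + d + (m * d - c) < a + b + c + d"
        by (elim disjE; linarith)
      then have "nat (b + (m * b - a) + d + (m * d - c)) < nat (a + b + c + d)"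
        using pos by simp
      then have "b = d \<and> m * b - a = m * d - c"
        using less.hyps independent_pair_rotate[OF ind] wide_root_reflect[OF ab A]
          wide_root_reflect[OF cd C] EF by blast
      then show ?thesis by auto
    qed
  next
    case 3
    have step: "0 < ceil_div (x * int (Suc j)) y - ceil_div (x * int j) y
        \<and> ceil_div (x * int (Suc j)) y - ceil_div (x * int j) y < m"
      if "0 < y" "y \<le> x" "x \<le> (m - 1) * y" for x y j
      using ceil_div_step[OF that, of j] by simp
    have "a \<le> (m - 1) * b" "c \<le> (m - 1) * d"
      using 3 r r' rr wide_root_le[OF ab] wide_root_le[OF cd] by auto
    then have "nat b = nat d \<and> ceil_div (a * int (nat b)) b = ceil_div (c * int (nat d)) d"
      using eq pos step unfolding christoffel_def by (intro staircase_eqD[OF ind m]) auto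
    then show ?thesis using pos ceil_div_mult[of b a] ceil_div_mult[of d c] by auto
  qed
qed

end

section \<open>Alternating products\<close>

context group
begin

text \<open>
  The elements with an alternating expression in proper powers of \<open>z True\<close> and \<open>z False\<close> that does not
  end in a power of \<open>z t\<close>.
\<close>

inductive alternating :: "int \<Rightarrow> (bool \<Rightarrow> 'a) \<Rightarrow> bool \<Rightarrow> 'a \<Rightarrow> bool" for m z where
  one: "alternating m z t \<one>"
| snoc: "alternating m z t g \<Longrightarrow> 0 < i \<Longrightarrow> i < m \<Longrightarrow> alternating m z (\<not> t) (g \<otimes> z t [^] i)"

lemma alternating_closed:
  "alternating m z t g \<Longrightarrow> (\<And>t. z t \<in> carrier G) \<Longrightarrow> g \<in> carrier G"
  by (induction rule: alternating.induct) auto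

lemma int_pow_mod_period:
  assumes "x \<in> carrier G" "x [^] (m::int) = \<one>"
  shows "x [^] i = x [^] (i mod m)"
proof -
  have "x [^] i = x [^] (m * (i div m) + i mod m)" by simp
  also have "\<dots> = (x [^] m) [^] (i div m) \<otimes> x [^] (i mod m)"
    using assms(1) by (simp only: int_pow_mult int_pow_pow)
  finally show ?thesis using assms by simp
qed

text \<open>
  Left multiplication by a power of \<open>z s\<close> adds, changes or removes only a first syllable.  It can
  therefore affect the type of the last syllable only if there is at most one syllable.  The alternative \<open>g = \<one>\<close> covers
  the product \<open>z s [^] i\<close>, which may end in a power of \<open>z s\<close> although \<open>\<one>\<close> does not.
\<close>

lemma alternating_left_mult:
  assumes z: "\<And>t. z t \<in> carrier G" "\<And>t. z t [^] m = \<one>" and m: "0 < m"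
    and "alternating m z t g"
  shows "if t = s then g = \<one> \<or> alternating m z t (z s [^] (i::int) \<otimes> g)
         else alternating m z t (z s [^] i \<otimes> g)"
  using assms(4)
proof (induction rule: alternating.induct)
  have single: "alternating m z (\<not> s) (z s [^] k)" for k :: int
  proof (cases "k mod m = 0")
    case True
    then show ?thesis using int_pow_mod_period[OF z(1)[of s] z(2), of k] by (simp add: alternating.one)
  next
    case False
    then have "0 < k mod m" "k mod m < m" using pos_mod_sign[OF m, of k] pos_mod_bound[OF m, of k] by linarith+
    then have "alternating m z (\<not> s) (\<one> \<otimes> z s [^] (k mod m))"
      by (intro alternating.snoc alternating.one)
    then show ?thesis using int_pow_mod_period[OF z(1)[of s] z(2), of k] z by simp
  qed
  {
    case (one t)
    show ?case using single[of i] z by (auto simp: alternating.one)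
  next
    case (snoc t g j)
    have g: "g \<in> carrier G" using snoc.hyps z alternating_closed by blast
    have assoc: "z s [^] i \<otimes> (g \<otimes> z t [^] j) = z s [^] i \<otimes> g \<otimes> z t [^] j"
      using g z by (simp add: m_assoc)
    have step: "alternating m z (\<not> t) (z s [^] i \<otimes> (g \<otimes> z t [^] j))"
      if "alternating m z t (z s [^] i \<otimes> g)"
      unfolding assoc using that snoc.hyps by (intro alternating.snoc)
    show ?case
    proof (cases "t = s")
      case True
      have "alternating m z (\<not> s) (z s [^] i \<otimes> (\<one> \<otimes> z s [^] j))"
        using single[of "i + j"] z by (simp add: int_pow_mult)
      then show ?thesis using snoc.IH step True by auto
    next
      case False
      then show ?thesis using snoc.IH step by auto
    qed
  }
qed

text \<open>
  It remains to exclude that an element has two alternating expressions with last syllables of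
  different types, which is a property of the particular group.
\<close>

lemma independent_pair_alternating:
  assumes z: "\<And>t. z t \<in> carrier G" "\<And>t. z t [^] m = \<one>" and m: "0 < m"
    and free: "\<And>t g i. alternating m z t g \<Longrightarrow> 0 < i \<Longrightarrow> i < m \<Longrightarrow> \<not> alternating m z t (g \<otimes> z t [^] i)"
  shows "independent_pair m (z True) (z False) {g. alternating m z True g} {g. alternating m z False g}"
proof -
  have left: "alternating m z (\<not> s) (z s [^] i \<otimes> g)" if "alternating m z (\<not> s) g" for s g and i :: int
    using alternating_left_mult[where z = z and m = m and t = "\<not> s" and s = s, OF z m that] by simp
  then show ?thesis
    using z free alternating.snoc[of m z True] alternating.snoc[of m z False] alternating_closed[of m z]
      left[of True] left[of False]
    unfolding independent_pair_def by (simp add: alternating.one subset_iff)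
qed

end

section \<open>The action of \<open>W(m)\<close> on normal forms\<close>

text \<open>
  Freeness of the rotations \<open>s\<^sub>2 s\<^sub>3\<close> and \<open>s\<^sub>2 s\<^sub>1\<close> is shown by a right action of \<open>W(m)\<close> on
  normal forms, that is on the cosets of \<open>{1, s\<^sub>2}\<close>.  A normal form is a list of syllables with the
  last one at the head; a syllable \<open>(True, i)\<close> stands for \<open>(s\<^sub>2 s\<^sub>3)\<^sup>i\<close>, and \<open>(False, i)\<close> for
  \<open>(s\<^sub>2 s\<^sub>1)\<^sup>i\<close>.
\<close>

type_synonym syllables = "(bool \<times> int) list"

fun exponent :: "bool \<Rightarrow> syllables \<Rightarrow> int" where
  "exponent t [] = 0"
| "exponent t ((s, i) # w) = (if s = t then i else 0)"

fun strip :: "bool \<Rightarrow> syllables \<Rightarrow> syllables" where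
  "strip t [] = []"
| "strip t ((s, i) # w) = (if s = t then w else (s, i) # w)"

definition attach :: "bool \<Rightarrow> int \<Rightarrow> syllables \<Rightarrow> syllables" where
  "attach t i w = (if i = 0 then w else (t, i) # w)"

text \<open>
  \<open>reduced m t w\<close> says that \<open>w\<close> is a normal form that does not end in a syllable of type \<open>t\<close>.
\<close>

inductive reduced :: "int \<Rightarrow> bool \<Rightarrow> syllables \<Rightarrow> bool" for m where
  Nil: "reduced m t []"
| Cons: "reduced m t w \<Longrightarrow> 0 < i \<Longrightarrow> i < m \<Longrightarrow> reduced m (\<not> t) ((t, i) # w)"

definition negate :: "int \<Rightarrow> syllables \<Rightarrow> syllables" where
  "negate m = map (\<lambda>(t, i). (t, m - i))"

text \<open>
  Conjugation by \<open>s\<^sub>2\<close> inverts both rotations, so \<open>s\<^sub>2\<close> negates all exponents.  As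
  \<open>s\<^sub>3 = s\<^sub>2 (s\<^sub>2 s\<^sub>3)\<close>, the generator \<open>s\<^sub>3\<close> negates all exponents and then adds \<open>1\<close> to the
  exponent of a last syllable of type \<open>True\<close>, which is taken to be \<open>0\<close> if the last syllable has the
  other type; similarly for \<open>s\<^sub>1\<close>.
\<close>

fun gen_action :: "int \<Rightarrow> gen \<Rightarrow> syllables \<Rightarrow> syllables" where
  "gen_action m S1 w = attach False ((1 - exponent False w) mod m) (negate m (strip False w))"
| "gen_action m S2 w = negate m w"
| "gen_action m S3 w = attach True ((1 - exponent True w) mod m) (negate m (strip True w))"

definition word_action :: "int \<Rightarrow> gen word \<Rightarrow> syllables \<Rightarrow> syllables" where
  "word_action m u w = foldl (\<lambda>w (g, e). gen_action m g w) w u"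

lemma word_action_simps [simp]:
  "word_action m [] w = w"
  "word_action m ((g, e) # u) w = word_action m u (gen_action m g w)"
  "word_action m (u @ v) w = word_action m v (word_action m u w)"
  by (simp_all add: word_action_def)

lemma reduced_strip:
  assumes "reduced m s w"
  shows "reduced m t (strip t w)" "0 < m \<Longrightarrow> 0 \<le> exponent t w" "0 < m \<Longrightarrow> exponent t w < m"
    "attach t (exponent t w) (strip t w) = w"
  using assms by (cases rule: reduced.cases; force simp: attach_def intro: reduced.intros)+

lemma strip_attach:
  assumes "reduced m t w"
  shows "strip t (attach t i w) = w" "exponent t (attach t i w) = i"
  using assms by (cases rule: reduced.cases; auto simp: attach_def)+

lemma reduced_attach:
  assumes "reduced m t w" "0 \<le> i" "i < m"
  shows "\<exists>s. reduced m s (attach t i w)"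
  using assms by (auto simp: attach_def intro!: exI reduced.intros)

lemma reduced_negate: "reduced m t w \<Longrightarrow> reduced m t (negate m w)"
  by (induction rule: reduced.induct) (auto simp: negate_def intro: reduced.intros)

lemma negate_negate [simp]: "negate m (negate m w) = w"
  by (induction w) (auto simp: negate_def)

lemma negate_attach:
  "0 \<le> i \<Longrightarrow> i < m \<Longrightarrow> negate m (attach t i w) = attach t ((- i) mod m) (negate m w)"
  by (auto simp: attach_def negate_def zmod_zminus1_eq_if)

text \<open>
  The generator other than \<open>s\<^sub>2\<close> that occurs in the rotation of type \<open>t\<close>.
\<close>

definition letter :: "bool \<Rightarrow> gen" where
  "letter t = (if t then S3 else S1)"

text \<open>
  On the fibre \<open>{attach t i w | i}\<close>, which is a copy of the integers modulo \<open>m\<close>, the two generators of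
  the dihedral subgroup of type \<open>t\<close> act as the reflections \<open>i \<mapsto> 1 - i\<close> and \<open>i \<mapsto> - i\<close>, while
  the remaining syllables are negated.  All relations of \<open>W(m)\<close> are visible in this form.
\<close>

lemma gen_action_attach:
  assumes "reduced m t w" "0 < m"
  shows "gen_action m (letter t) (attach t (i mod m) w) = attach t ((1 - i) mod m) (negate m w)"
    and "gen_action m S2 (attach t (i mod m) w) = attach t ((- i) mod m) (negate m w)"
  using assms strip_attach[OF assms(1)] negate_attach[of "i mod m" m t w]
  by (cases t; simp add: letter_def mod_diff_right_eq mod_minus_eq)+

lemma attach_cases:
  assumes "reduced m s w" "0 < m"
  obtains v i where "reduced m t v" "w = attach t (i mod m) v"
  using reduced_strip[OF assms(1), of t] assms(2) that[of "strip t w" "exponent t w"] by simp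

lemma reduced_gen_action:
  assumes "reduced m s w" "0 < m"
  shows "\<exists>s. reduced m s (gen_action m g w)"
proof -
  have "\<exists>s. reduced m s (gen_action m (letter t) w)" for t
    using attach_cases[OF assms, of t] gen_action_attach(1)[OF _ assms(2)] reduced_attach reduced_negate
      assms(2) by (metis pos_mod_bound pos_mod_sign)
  from this[of True] this[of False] show ?thesis
    using reduced_negate[OF assms(1)] by (cases g) (auto simp: letter_def)
qed

lemma reduced_word_action:
  "reduced m s w \<Longrightarrow> 0 < m \<Longrightarrow> \<exists>s. reduced m s (word_action m u w)"
  by (induction u arbitrary: s w) (use reduced_gen_action in force)+

lemma gen_action_involution:
  assumes "reduced m s w" "0 < m"
  shows "gen_action m g (gen_action m g w) = w"
proof -
  have "gen_action m (letter t) (gen_action m (letter t) w) = w" for t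
  proof -
    obtain v i where v: "reduced m t v" "w = attach t (i mod m) v"
      using attach_cases[OF assms] by blast
    show ?thesis
      using gen_action_attach(1)[OF v(1) assms(2), of i]
        gen_action_attach(1)[OF reduced_negate[OF v(1)] assms(2), of "1 - i"] v(2) by simp
  qed
  from this[of True] this[of False] show ?thesis by (cases g) (auto simp: letter_def)
qed

lemma rotation_action:
  assumes "reduced m t w" "0 < m"
  shows "word_action m (concat (replicate k [(S2, e), (letter t, e')])) (attach t (i mod m) w)
       = attach t ((i + int k) mod m) w"
    and "word_action m (concat (replicate k [(letter t, e), (S2, e')])) (attach t (i mod m) w)
       = attach t ((i - int k) mod m) w"
  using gen_action_attach[OF assms] gen_action_attach[OF reduced_negate[OF assms(1)] assms(2)]
  by (induction k arbitrary: i) (simp_all add: algebra_simps)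

lemma pres_eq_word_action:
  assumes "pres_eq (W_relators m) u v" "0 < m" "reduced (int m) s w"
  shows "word_action (int m) u w = word_action (int m) v w"
  using assms
proof (induction arbitrary: s w rule: pres_eq.induct)
  case (cancel u g e v)
  then obtain s' where "reduced (int m) s' (word_action (int m) u w)"
    using reduced_word_action by (metis of_nat_0_less_iff)
  then show ?case using cancel gen_action_involution[of "int m"] by simp
next
  case (relator r u v)
  let ?w = "word_action (int m) u w"
  obtain s' where w: "reduced (int m) s' ?w"
    using reduced_word_action relator by (metis of_nat_0_less_iff)
  have m: "0 < int m" using relator by simp
  obtain x i where x: "reduced (int m) True x" "?w = attach True (i mod int m) x"
    using attach_cases[OF w m] by blast
  obtain y j where y: "reduced (int m) False y" "?w = attach False (j mod int m) y"
    using attach_cases[OF w m] by blast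
  have "word_action (int m) r ?w = ?w"
    using relator(1) gen_action_involution[OF w m]
      rotation_action(1)[OF x(1) m, of m True True i] rotation_action(2)[OF y(1) m, of m True True j]
    by (auto simp: W_relators_def letter_def x(2)[symmetric] y(2)[symmetric] simp del: gen_action.simps)
  then show ?case by simp
qed auto

definition rotation_word :: "bool \<Rightarrow> gen word" where
  "rotation_word t = [(S2, True), (letter t, True)]"

definition rotation :: "nat \<Rightarrow> bool \<Rightarrow> gen word set" where
  "rotation m t = W_gen m S2 \<otimes>\<^bsub>W m\<^esub> W_gen m (letter t)"

lemma group_W: "group (W m)"
  unfolding W_def by (rule group_presented_group)

lemma W_one: "\<one>\<^bsub>W m\<^esub> = pres_class (W_relators m) []"
  by (simp add: W_def presented_group_def)

lemma W_mult:
  "pres_class (W_relators m) u \<otimes>\<^bsub>W m\<^esub> pres_class (W_relators m) v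
    = pres_class (W_relators m) (u @ v)"
  by (simp add: W_def presented_group_mult)

lemma W_pow:
  "pres_class (W_relators m) u [^]\<^bsub>W m\<^esub> k = pres_class (W_relators m) (concat (replicate k u))"
proof (induction k)
  case 0
  interpret group "W m" by (rule group_W)
  show ?case by (simp add: W_one)
next
  case (Suc k)
  interpret group "W m" by (rule group_W)
  have "concat (replicate (Suc k) u) = concat (replicate k u) @ u"
    using replicate_append_same[of k u] by (metis concat.simps concat_append append_Nil2 replicate_Suc)
  then show ?case using Suc by (simp add: W_mult)
qed

lemma rotation_eq: "rotation m t = pres_class (W_relators m) (rotation_word t)"
  by (simp add: rotation_def W_gen_def pres_gen_def W_mult rotation_word_def)

lemma pres_class_carrier: "pres_class (W_relators m) u \<in> carrier (W m)"
  by (simp add: W_def presented_group_def)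

lemma rotation_closed: "rotation m t \<in> carrier (W m)"
  by (simp add: rotation_eq pres_class_carrier)

lemma rotation_pow_order: "rotation m t [^]\<^bsub>W m\<^esub> int m = \<one>\<^bsub>W m\<^esub>"
proof -
  interpret group "W m" by (rule group_W)
  have rel: "pres_class (W_relators m) r = \<one>\<^bsub>W m\<^esub>" if "r \<in> W_relators m" for r
    using pres_eq.relator[OF that, of "[]" "[]"] by (simp add: W_one pres_class_eq_iff)
  show ?thesis
  proof (cases t)
    case True
    have "rotation m t [^]\<^bsub>W m\<^esub> m = \<one>\<^bsub>W m\<^esub>"
      unfolding rotation_eq W_pow
      by (rule rel) (simp add: W_relators_def rotation_word_def letter_def True)
    then show ?thesis by (simp add: int_pow_int)
  next
    case False
    \<comment> \<open>\<open>s\<^sub>2 s\<^sub>1\<close> is the inverse of \<open>s\<^sub>1 s\<^sub>2\<close>, whose \<open>m\<close>-th power is a relator\<close>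
    let ?x = "pres_class (W_relators m) [(S1, True), (S2, True)]"
    have "pres_class (W_relators m) [(S2, True), (S2, True)] = \<one>\<^bsub>W m\<^esub>"
      "pres_class (W_relators m) [(S1, True), (S1, True)] = \<one>\<^bsub>W m\<^esub>"
      by (rule rel; simp add: W_relators_def)+
    then have "rotation m t \<otimes>\<^bsub>W m\<^esub> ?x = \<one>\<^bsub>W m\<^esub>"
      using False pres_eq_context[of "W_relators m" "[(S1, True), (S1, True)]" "[]" "[(S2, True)]" "[(S2, True)]"]
      by (simp add: rotation_eq rotation_word_def letter_def W_mult W_one flip: pres_class_eq_iff)
    then have "rotation m t = inv\<^bsub>W m\<^esub> ?x"
      using inv_equality[of "rotation m t" ?x] by (simp add: pres_class_carrier rotation_closed)
    moreover have "?x [^]\<^bsub>W m\<^esub> m = \<one>\<^bsub>W m\<^esub>"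
      unfolding W_pow by (rule rel) (simp add: W_relators_def)
    ultimately show ?thesis
      using nat_pow_inv[of ?x m] by (simp add: int_pow_int pres_class_carrier)
  qed
qed

text \<open>
  Right multiplication by a rotation adds a syllable, so the action on the empty list computes normal
  forms.
\<close>

lemma rotation_snoc:
  assumes "g = pres_class (W_relators m) u" "reduced (int m) t (word_action (int m) u [])"
    and i: "0 < i" "i < int m"
  obtains v where "g \<otimes>\<^bsub>W m\<^esub> rotation m t [^]\<^bsub>W m\<^esub> i = pres_class (W_relators m) v"
    "word_action (int m) v [] = (t, i) # word_action (int m) u []"
proof
  let ?r = "concat (replicate (nat i) (rotation_word t))"
  have "rotation m t [^]\<^bsub>W m\<^esub> i = rotation m t [^]\<^bsub>W m\<^esub> nat i"
    using i by simp
  also have "\<dots> = pres_class (W_relators m) ?r"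
    unfolding rotation_eq by (rule W_pow)
  finally show "g \<otimes>\<^bsub>W m\<^esub> rotation m t [^]\<^bsub>W m\<^esub> i = pres_class (W_relators m) (u @ ?r)"
    by (simp add: assms(1) W_mult)
  show "word_action (int m) (u @ ?r) [] = (t, i) # word_action (int m) u []"
    using rotation_action(1)[OF assms(2), of "nat i" True True 0] i
    by (simp add: rotation_word_def attach_def)
qed

lemma alternating_reduced:
  assumes "group.alternating (W m) (int m) (rotation m) t g"
  shows "\<exists>u. g = pres_class (W_relators m) u \<and> reduced (int m) t (word_action (int m) u [])"
proof -
  interpret group "W m" by (rule group_W)
  show ?thesis using assms
  proof (induction rule: alternating.induct)
    case (one t)
    then show ?case by (intro exI[of _ "[]"]) (simp add: W_one reduced.Nil)
  next
    case (snoc t g i)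
    then obtain u where u: "g = pres_class (W_relators m) u" "reduced (int m) t (word_action (int m) u [])"
      by blast
    with snoc.hyps show ?case by (metis rotation_snoc reduced.Cons)
  qed
qed

text \<open>
  Two words for one element move the empty list to the same normal form, whose head shows the type of
  the last syllable.
\<close>

lemma independent_pair_rotations:
  assumes "2 \<le> m"
  shows "\<exists>P Q. group.independent_pair (W m) (int m) (rotation m True) (rotation m False) P Q"
proof -
  interpret group "W m" by (rule group_W)
  have "\<not> alternating (int m) (rotation m) t (g \<otimes>\<^bsub>W m\<^esub> rotation m t [^]\<^bsub>W m\<^esub> i)"
    if g: "alternating (int m) (rotation m) t g" and i: "0 < i" "i < int m" for t g i
  proof
    let ?h = "g \<otimes>\<^bsub>W m\<^esub> rotation m t [^]\<^bsub>W m\<^esub> i"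
    assume "alternating (int m) (rotation m) t ?h"
    then obtain u where u: "?h = pres_class (W_relators m) u"
      "reduced (int m) t (word_action (int m) u [])"
      using alternating_reduced by blast
    obtain w where "g = pres_class (W_relators m) w" "reduced (int m) t (word_action (int m) w [])"
      using alternating_reduced[OF g] by blast
    then obtain v where v: "?h = pres_class (W_relators m) v"
      "word_action (int m) v [] = (t, i) # word_action (int m) w []"
      using rotation_snoc i by metis
    have "pres_eq (W_relators m) u v" using u v by (simp flip: pres_class_eq_iff)
    then have "word_action (int m) u [] = word_action (int m) v []"
      using assms by (intro pres_eq_word_action[OF _ _ reduced.Nil]) auto
    then show False using u(2) v(2) by (auto elim: reduced.cases)
  qed
  then show ?thesis
    using independent_pair_alternating[of "rotation m" "int m"] rotation_closed rotation_pow_order assms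
    by (metis of_nat_0_less_iff less_le_trans zero_less_numeral)
qed

section \<open>Maximal Dyck paths as staircases\<close>

text \<open>
  The second inequality of \<open>near\<close> says that the point one step further up along the antidiagonal lies
  strictly above the diagonal, so no Dyck path passes higher.
\<close>

lemma maximal_dyck_path_criterion:
  assumes "0 < a" "0 < b" "count_list p Horizontal = a" "count_list p Vertical = b"
    and near: "\<And>k. a * count_list (take k p) Vertical \<le> b * count_list (take k p) Horizontal
         \<and> b * count_list (take k p) Horizontal < a * (count_list (take k p) Vertical + 1) + b"
  shows "maximal_dyck_path a b p"
  unfolding maximal_dyck_path_def
proof (intro conjI allI impI)
  show "dyck_path a b p" using assms by (simp add: dyck_path_def)
  fix q k assume q: "dyck_path a b q" and k: "k \<le> a + b"
  let ?v = "count_list (take k p) Vertical" and ?h = "count_list (take k p) Horizontal"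
  let ?v' = "count_list (take k q) Vertical" and ?h' = "count_list (take k q) Horizontal"
  show "?v' \<le> ?v"
  proof (rule ccontr)
    assume "\<not> ?v' \<le> ?v"
    then have v: "?v + 1 \<le> ?v'" by simp
    have len: "length p = a + b" "length q = a + b"
      using assms(3,4) q count_list_edge[of p] count_list_edge[of q] by (auto simp: dyck_path_def)
    then have "?h + ?v = ?h' + ?v'"
      using count_list_edge[of "take k p"] count_list_edge[of "take k q"] by simp
    with v have h: "?h' + 1 \<le> ?h" by simp
    have "a * (?v + 1) + b \<le> a * ?v' + b" using mult_le_mono2[OF v, of a] by simp
    also have "\<dots> \<le> b * ?h' + b" using q k len by (simp add: dyck_path_def)
    also have "\<dots> = b * (?h' + 1)" by simp
    also have "\<dots> \<le> b * ?h" using h by (rule mult_le_mono2)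
    finally show False using near[of k] by simp
  qed
qed

lemma count_list_replicate_edge: "count_list (replicate n x) y = (if x = y then n else 0)"
  by (induction n) auto

primrec staircase_path :: "(nat \<Rightarrow> int) \<Rightarrow> nat \<Rightarrow> edge list" where
  "staircase_path c 0 = []"
| "staircase_path c (Suc n) =
     staircase_path c n @ replicate (nat (c (Suc n) - c n)) Horizontal @ [Vertical]"

lemma count_staircase_path:
  assumes "\<And>j. c j \<le> c (Suc j)" "c 0 = 0"
  shows "int (count_list (staircase_path c n) Horizontal) = c n"
    and "count_list (staircase_path c n) Vertical = n"
  using assms by (induction n) (auto simp: count_list_replicate_edge)

lemma all_take_snoc:
  assumes "\<forall>k. \<phi> (take k l)" "\<phi> (l @ [e])"
  shows "\<forall>k. \<phi> (take k (l @ [e]))"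
  using assms by (metis append_take_drop_id take_all linorder_le_cases length_append_singleton
      not_less_eq_eq take_append take_all_iff take0 append_Nil2 diff_is_0_eq)

lemma maximal_dyck_path_staircase:
  assumes ab: "0 < a" "0 < b"
  defines "c \<equiv> \<lambda>j. ceil_div (int a * int j) (int b)"
  shows "maximal_dyck_path a b (staircase_path c b)"
proof (rule maximal_dyck_path_criterion[OF ab])
  \<comment> \<open>\<open>lower\<close> is used at the left end of a tread and \<open>upper\<close> at its right end; the other vertices
     of the tread lie in between\<close>
  have lower: "int a * int j \<le> c j * int b" for j
    using ceil_div_le_iff[of "int b" "int a * int j" "c j"] ab by (simp add: c_def)
  have upper: "c j * int b < int a * int j + int b" for j
    using ceil_div_le_iff[of "int b" "int a * int j" "c j - 1"] ab by (simp add: c_def algebra_simps)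
  have mono: "c j \<le> c (Suc j)" for j
  proof -
    have "int a * int j \<le> c (Suc j) * int b" using lower[of "Suc j"] by (simp add: algebra_simps)
    then show ?thesis using ceil_div_le_iff[of "int b" _ "c (Suc j)"] ab by (simp add: c_def)
  qed
  have c0: "c 0 = 0" by (simp add: c_def)
  note count = count_staircase_path[of c, OF mono c0]
  show "count_list (staircase_path c b) Horizontal = a" "count_list (staircase_path c b) Vertical = b"
    using count[of b] ceil_div_mult[of "int b" "int a"] ab by (auto simp: c_def)
  define near where "near l \<longleftrightarrow>
      a * count_list l Vertical \<le> b * count_list l Horizontal \<and>
      b * count_list l Horizontal < a * (count_list l Vertical + 1) + b" for l
  have near_iff: "near l \<longleftrightarrow>
      int a * int (count_list l Vertical) \<le> int (count_list l Horizontal) * int b \<and>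
      int (count_list l Horizontal) * int b < int a * int (count_list l Vertical + 1) + int b" for l
    unfolding near_def by (simp add: mult.commute flip: of_nat_mult of_nat_add of_nat_Suc)
  have "\<forall>k. near (take k (staircase_path c n))" for n
  proof (induction n)
    case 0
    then show ?case using ab by (simp add: near_def)
  next
    case (Suc n)
    let ?l = "\<lambda>i. staircase_path c n @ replicate i Horizontal"
    have "\<forall>k. near (take k (?l i))" if "int i \<le> c (Suc n) - c n" for i
      using that
    proof (induction i)
      case (Suc i)
      have "near (?l i @ [Horizontal])"
      proof -
        have "(c n + int (Suc i)) * int b \<le> c (Suc n) * int b"
          using Suc.prems ab by (intro mult_right_mono) auto
        moreover have "c n * int b \<le> (c n + int (Suc i)) * int b"
          using ab by (intro mult_right_mono) auto
        ultimately show ?thesis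
          using count[of n] lower[of n] upper[of "Suc n"]
          by (simp add: near_iff count_list_replicate_edge add_ac)
      qed
      then have "\<forall>k. near (take k (?l i @ [Horizontal]))"
        using Suc by (intro all_take_snoc) auto
      then show ?case by (simp add: replicate_append_same)
    qed (use Suc.IH in simp)
    moreover have "near (staircase_path c (Suc n))"
      using count[of "Suc n"] lower[of "Suc n"] upper[of "Suc n"] ab
      by (simp add: near_iff algebra_simps del: staircase_path.simps)
    ultimately have "\<forall>k. near (take k (?l (nat (c (Suc n) - c n)) @ [Vertical]))"
      using mono[of n] by (intro all_take_snoc) auto
    then show ?case by simp
  qed
  then show "a * count_list (take k (staircase_path c b)) Vertical
        \<le> b * count_list (take k (staircase_path c b)) Horizontal
      \<and> b * count_list (take k (staircase_path c b)) Horizontal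
        < a * (count_list (take k (staircase_path c b)) Vertical + 1) + b" for k
    by (simp add: near_def)
qed

lemma (in group) foldr_mult_append:
  assumes "\<And>e. f e \<in> carrier G"
  shows "foldr (\<lambda>e x. f e \<otimes> x) l \<one> \<in> carrier G"
    and "foldr (\<lambda>e x. f e \<otimes> x) (l @ r) \<one> = foldr (\<lambda>e x. f e \<otimes> x) l \<one> \<otimes> foldr (\<lambda>e x. f e \<otimes> x) r \<one>"
proof -
  show closed: "foldr (\<lambda>e x. f e \<otimes> x) l \<one> \<in> carrier G" for l
    using assms by (induction l) auto
  show "foldr (\<lambda>e x. f e \<otimes> x) (l @ r) \<one> = foldr (\<lambda>e x. f e \<otimes> x) l \<one> \<otimes> foldr (\<lambda>e x. f e \<otimes> x) r \<one>"
    using assms closed by (induction l) (auto simp: m_assoc)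
qed

lemma (in group) foldr_mult_staircase_path:
  assumes f: "\<And>e. f e \<in> carrier G" and mono: "\<And>j. c j \<le> c (Suc j)"
  shows "foldr (\<lambda>e x. f e \<otimes> x) (staircase_path c n) \<one> = staircase (f Horizontal) (f Vertical) c n"
proof (induction n)
  case (Suc n)
  have "foldr (\<lambda>e x. f e \<otimes> x) (replicate k Horizontal) \<one> = f Horizontal [^] k" for k :: nat
  proof (induction k)
    case (Suc k)
    have "foldr (\<lambda>e x. f e \<otimes> x) (replicate (Suc k) Horizontal) \<one> = f Horizontal \<otimes> f Horizontal [^] k"
      unfolding Suc.IH[symmetric] by (simp only: replicate_Suc foldr_Cons o_apply)
    then show ?case by (simp only: nat_pow_Suc2[OF f])
  qed simp
  moreover have "f Horizontal [^] nat (c (Suc n) - c n) = f Horizontal [^] (c (Suc n) - c n)"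
    using mono[of n] by simp
  ultimately show ?case
    using f Suc by (simp add: foldr_mult_append m_assoc del: foldr_append)
qed simp

lemma edge_elt_rotation:
  "edge_elt m Horizontal = rotation m True" "edge_elt m Vertical = rotation m False"
  by (simp_all add: rotation_def letter_def)

lemma edge_elt_closed: "edge_elt m e \<in> carrier (W m)"
  using edge_elt_rotation rotation_closed by (cases e) (metis)+

lemma s_dyck_christoffel:
  assumes "0 < a" "0 < b"
  shows "s_dyck m (nat a) (nat b) = group.christoffel (W m) (rotation m True) (rotation m False) a b"
proof -
  interpret group "W m" by (rule group_W)
  let ?c = "\<lambda>j. ceil_div (a * int j) b"
  have "maximal_dyck_path (nat a) (nat b) (staircase_path ?c (nat b))"
    using maximal_dyck_path_staircase[of "nat a" "nat b"] assms by simp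
  then have path: "the_maximal_dyck_path (nat a) (nat b) = staircase_path ?c (nat b)"
    unfolding the_maximal_dyck_path_def
    using ex1_maximal_dyck_path[of "nat a" "nat b"] assms by (intro the1_equality) auto
  have mono: "?c j \<le> ?c (Suc j)" for j
    unfolding ceil_div_def using assms by (auto intro!: zdiv_mono1)
  show ?thesis
    using foldr_mult_staircase_path[of "edge_elt m" ?c "nat b", OF edge_elt_closed mono]
    by (simp add: s_dyck_def path christoffel_def edge_elt_rotation del: edge_elt.simps)
qed

section \<open>Injectivity\<close>

theorem theorem3p4:
  fixes m :: nat
  assumes "m \<ge> 2"
  shows "(\<lambda>(a, b). s_dyck m (nat a) (nat b))
           \<in> {(a, b) \<in> reduced_positive_roots m. a \<ge> b} \<rightarrow> carrier (W m)
       \<and> inj_on (\<lambda>(a, b). s_dyck m (nat a) (nat b))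
           {(a, b) \<in> reduced_positive_roots m. a \<ge> b}"
proof -
  interpret group "W m" by (rule group_W)
  let ?E = "christoffel (rotation m True) (rotation m False)"
  obtain P Q where ind: "independent_pair (int m) (rotation m True) (rotation m False) P Q"
    using independent_pair_rotations[OF assms] by blast
  have root: "wide_root (int m) a b" if "(a, b) \<in> reduced_positive_roots m" "b \<le> a" for a b
    using that by (simp add: reduced_positive_roots_iff wide_root_def)
  have s: "s_dyck m (nat a) (nat b) = ?E a b" if "wide_root (int m) a b" for a b
    using that by (intro s_dyck_christoffel) (auto simp: wide_root_def)
  have "?E a b \<in> carrier (W m)" for a b
    by (simp add: christoffel_def staircase_closed rotation_closed)
  moreover have inj: "a = c \<and> b = d" if "wide_root (int m) a b" "wide_root (int m) c d" "?E a b = ?E c d" for a b c d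
    using christoffel_inj[OF ind _ that] assms by simp
  moreover have "inj_on (\<lambda>(a, b). s_dyck m (nat a) (nat b)) {(a, b) \<in> reduced_positive_roots m. a \<ge> b}"
    by (rule inj_onI) (auto simp: s root dest!: inj[rotated 2])
  ultimately show ?thesis by (auto simp: s root)
qed

end
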